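(* Let $m\ge3$ be an integer, let $u,v,w$ be variables, and let $$Q(u):=u^m-i^m,\qquad W(u,v,w):=iu^2v^2+u^2v+uv^2-2wuv+u+v-i,$$ where $i=\sqrt{-1}$. Let $$D(w)=\frac{1}{2^{m^2}w^{3m-2}}\operatorname{Res}_u\Big(Q(u),\ \operatorname{Res}_v\big(Q(v),\,W(u,v,w)\big)\Big).$$ Then $D(w)$ is an even, monic polynomial in $w$ of degree $(m-1)(m-2)$. Furthermore, for all sufficiently small $\tau$, with $V_0(m):=(m-1)(m-2)$, $$\sum_{n\ge0}V_n(m)\,\tau^n=(m-1)(m-2)-\sqrt{c_m\tau}\,\frac{D'(\sqrt{c_m\tau})}{D(\sqrt{c_m\tau})},\qquad c_m:=\frac{3m^2}{4}.$$
   Context: For integers $n\ge1$, $m\ge3$, the $\mathrm{SU}(3)$ Verlinde sum is $$V_n(m)=3^nm^{2n}\sum_{\substack{(j,\ell,k)\in(\mathbb Z/m\mathbb Z\setminus\{0\})^3\\ j+\ell+k\equiv 0 \bmod m}}\Big(8\sin\frac{\pi j}{m}\sin\frac{\pi\ell}{m}\sin\frac{\pi k}{m}\Big)^{-2n}.$$ By convention $V_0(m):=(m-1)(m-2)$. $\operatorname{Res}_x(f,g)$ denotes the resultant of $f$ and $g$ regarded as polynomials in $x$, i.e. the determinant of their Sylvester matrix; for $f$ monic with roots $\alpha_1,\dots,\alpha_d$ it equals $\prod_i g(\alpha_i)$. Since $D$ is even, $v\mapsto vD'(v)/D(v)$ is an even function, so the right-hand side of the generating series identity does not depend on the choice of square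 root. *)

theory Defs
  imports
    Complex_Main
    "HOL-Computational_Algebra.Polynomial_Factorial"
    "HOL-Number_Theory.Cong"
    "Subresultants.Resultant_Prelim"
begin

text \<open>
  Nonzero residue classes modulo \<open>m\<close> are represented by \<open>1, \<dots>, m - 1\<close>. The choice is immaterial
  below: shifting a representative by \<open>m\<close> only changes the sign of the sine, and the exponent
  \<open>-2n\<close> is even.
\<close>

definition verlinde_triples :: "nat \<Rightarrow> (nat \<times> nat \<times> nat) set" where
  "verlinde_triples m =
     {(j, l, k). j \<in> {1..<m} \<and> l \<in> {1..<m} \<and> k \<in> {1..<m} \<and> [j + l + k = 0] (mod m)}"

definition verlinde_SU3 :: "nat \<Rightarrow> nat \<Rightarrow> real" where
  "verlinde_SU3 n m =
     (if n = 0 then (real m - 1) * (real m - 2)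
      else 3 ^ n * real m ^ (2 * n) *
        (\<Sum>(j, l, k)\<in>verlinde_triples m.
           (8 * sin (pi * real j / real m) * sin (pi * real l / real m) * sin (pi * real k / real m))
             powi (- (2 * int n))))"

text \<open>
  Polynomials in \<open>w\<close>, \<open>u\<close>, \<open>v\<close> live in the tower \<open>complex poly poly poly\<close>, read as \<open>\<complex>[w][u][v]\<close>:
  the outermost variable is \<open>v\<close>, the innermost is \<open>w\<close>. Hence a resultant over this type
  eliminates \<open>v\<close> and gives an element of \<open>\<complex>[w][u]\<close>, and a resultant over \<open>complex poly poly\<close>
  eliminates \<open>u\<close> and gives an element of \<open>\<complex>[w]\<close>.
\<close>

definition W_poly :: "complex poly poly poly" where
  "W_poly =
     (let w = [:[:[:0, 1:]:]:]; u = [:[:0, 1:]:]; v = [:0, 1:]; I = [:[:[:\<i>:]:]:]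
      in I * u^2 * v^2 + u^2 * v + u * v^2 - 2 * w * u * v + u + v - I)"

text \<open>
  The polynomial \<open>x^m - I^m\<close> in the outermost variable \<open>x\<close>, where \<open>I\<close> is the image of the imaginary
  unit in the coefficient ring. It is used for \<open>Q(v)\<close> over \<open>\<complex>[w][u]\<close> and for \<open>Q(u)\<close> over \<open>\<complex>[w]\<close>.
\<close>

definition Q_poly :: "nat \<Rightarrow> 'a::comm_ring_1 \<Rightarrow> 'a poly" where
  "Q_poly m I = [:0, 1:] ^ m - [:I ^ m:]"

definition iterated_resultant :: "nat \<Rightarrow> complex poly" where
  "iterated_resultant m =
     resultant (Q_poly m [:\<i>:]) (resultant (Q_poly m [:[:\<i>:]:]) W_poly)"

text \<open>
  A priori only a rational function in \<open>w\<close>; that it is a polynomial is part of the theorem.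
\<close>

definition D_fract :: "nat \<Rightarrow> complex poly fract" where
  "D_fract m = Fract (iterated_resultant m) (monom (2 ^ (m ^ 2)) (3 * m - 2))"

end

theory Submission
  imports Defs
begin

text \<open>
  Since \<open>Q\<close> is monic with roots \<open>i a\<close>, \<open>a\<^sup>m = 1\<close>, the iterated resultant is the product of the values
  \<open>W(i a, i b, w) = 2 a b w + i (a - 1) (b - 1) (a b - 1)\<close> over pairs of \<open>m\<close>-th roots of unity. For
  \<open>a = exp(2 \<pi> i j / m)\<close> and \<open>b = exp(2 \<pi> i l / m)\<close> this is \<open>2 a b (w + x)\<close> with
  \<open>x = 4 sin(\<pi> j / m) sin(\<pi> l / m) sin(\<pi> (j + l) / m)\<close>. The \<open>3 m - 2\<close> pairs with \<open>a = 1\<close>, \<open>b = 1\<close>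
  or \<open>a b = 1\<close> give \<open>x = 0\<close>, so \<open>D\<close> is the product of \<open>w + x\<close> over the other pairs, whose third
  angle is determined by \<open>j + l + k \<equiv> 0\<close>. Thus \<open>V\<^sub>n(m)\<close> is the sum of \<open>(c\<^sub>m / x\<^sup>2)\<^sup>n\<close>, and the generating
  series is a finite sum of geometric series, which is the logarithmic derivative of \<open>D\<close> up to
  the symmetry \<open>x \<mapsto> - x\<close>.
\<close>

subsection \<open>Resultants of split monic polynomials\<close>

text \<open>In row \<open>i\<close> only the diagonal entry and its right neighbour survive; the
  last row has no such neighbour, hence the guard \<open>Suc i < N\<close>. This evaluates the row
  operations \<open>L * S\<close> below.\<close>

lemma sum_bidiagonal:
  fixes X :: "nat \<Rightarrow> 'a::comm_ring_1"
  assumes "i < N"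
  shows "(\<Sum>k = 0..<N. (if k = i then 1 else if P \<and> k = Suc i then - c else 0) * X k) =
         X i - (if P \<and> Suc i < N then c * X (Suc i) else 0)"
proof -
  have "(\<Sum>k = 0..<N. (if k = i then 1 else if P \<and> k = Suc i then - c else 0) * X k) =
        (\<Sum>k = 0..<N. (if k = i then X k else 0) + (if k = Suc i then (if P then - c * X k else 0) else 0))"
    by (rule sum.cong) auto
  also have "\<dots> = X i - (if P \<and> Suc i < N then c * X (Suc i) else 0)"
    using assms by (simp add: sum.distrib)
  finally show ?thesis .
qed

lemma det_bidiagonal:
  fixes c :: "'a::comm_ring_1"
  shows "det (mat N N (\<lambda>(i, k). if k = i then 1 else if P i \<and> k = Suc i then - c else 0)) = 1"
proof -
  let ?A = "mat N N (\<lambda>(i, k). if k = i then 1 else if P i \<and> k = Suc i then - c else 0)"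
  have "upper_triangular ?A"
    by (rule upper_triangularI) auto
  then have "det ?A = prod_list (diag_mat ?A)"
    by (rule det_upper_triangular[of _ N]) simp
  also have "\<dots> = 1"
    by (simp add: prod_list_diag_prod)
  finally show ?thesis .
qed

lemma coeff_linear_mult_Suc:
  fixes h :: "'a::comm_ring_1 poly"
  shows "coeff ([:- a, 1:] * h) (Suc k) = coeff h k - a * coeff h (Suc k)"
  by (simp add: mult_pCons_left)

text \<open>
  The Sylvester matrix of \<open>(x - a) p\<close> and \<open>g\<close> is brought to block triangular form by passing, on both
  sides, from monomials to the basis \<open>1, (x - a), (x - a) x, \<dots>\<close>. Both base changes are
  unitriangular, and the corner block is \<open>g(a)\<close>.
\<close>
lemma resultant_linear_mult_left:
  fixes p g :: "'a::idom poly"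
  assumes "p \<noteq> 0"
  shows "resultant ([:- a, 1:] * p) g = poly g a * resultant p g"
proof -
  define f where "f = [:- a, 1:] * p"
  define e where "e = degree g"
  define M where "M = degree p + e"
  define N where "N = Suc M"
  define q where "q = synthetic_div g a"
  have degf: "degree f = Suc (degree p)"
    unfolding f_def using assms by (subst degree_mult_eq) auto
  have g: "g = [:- a, 1:] * q + [:poly g a:]"
    unfolding q_def using synthetic_div_correct'[of a g] by simp
  have degq: "degree q = e - 1"
    by (simp add: q_def e_def degree_synthetic_div)
  define h where "h i = (if i < e then monom 1 (e - i) * p
    else if i < M then monom 1 (M - i) * g else monom 1 1 * q)" for i
  have h0: "coeff (h i) 0 = 0" if "i \<le> M" for i
    using that by (auto simp: h_def coeff_monom_mult)
  \<comment> \<open>Needed in column \<open>0\<close> of \<open>B * R\<close>, which has no column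
    to its left.\<close>
  have hM: "coeff (h i) (Suc M) = 0" if "i \<le> M" for i
  proof -
    \<comment> \<open>For constant \<open>g\<close> the truncated \<open>e - 1\<close> gives no drop
      in degree; there the quotient itself is zero.\<close>
    have "e = 0 \<longrightarrow> q = 0"
      by (auto simp: q_def e_def synthetic_div_eq_0_iff)
    moreover have "e \<le> M" by (simp add: M_def)
    ultimately have "coeff q M = 0"
      by (cases "e = 0") (auto intro!: coeff_eq_0 simp: degq)
    moreover have "coeff g (Suc i) = 0" if "e \<le> i" for i
      using that by (intro coeff_eq_0) (auto simp: e_def)
    moreover have "coeff p (Suc (M + i) - e) = 0" for i
      by (intro coeff_eq_0) (auto simp: M_def)
    ultimately show ?thesis
      using that by (auto simp: h_def coeff_monom_mult Suc_diff_le M_def)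
  qed
  define S where "S = sylvester_mat f g"
  \<comment> \<open>\<open>L\<close> subtracts \<open>a\<close> times the next row, only in the rows
    of \<open>g\<close>, as those of \<open>f\<close> already contain \<open>x - a\<close>. Right
    multiplication by \<open>R\<close> performs multiplication by \<open>x - a\<close> on
    coefficient lists.\<close>
  define L where "L = mat N N (\<lambda>(i, k). if k = i then 1 else if e \<le> i \<and> k = Suc i then - a else 0)"
  define R where "R = mat N N (\<lambda>(i, k). if k = i then 1 else if True \<and> k = Suc i then - a else 0)"
  define B where "B = mat N N (\<lambda>(i, j). coeff (h i) (M - j) + (if i = M \<and> j = M then poly g a else 0))"
  have carr: "S \<in> carrier_mat N N" "L \<in> carrier_mat N N" "R \<in> carrier_mat N N" "B \<in> carrier_mat N N"
    using sylvester_carrier_mat[of f g]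
    by (auto simp: S_def L_def R_def B_def N_def M_def degf e_def)
  have S: "S $$ (i, j) = (if i < e then coeff (monom 1 (e - i) * f) (N - j)
             else coeff (monom 1 (N - i) * g) (N - j))" if "i < N" "j < N" for i j
    unfolding S_def using that
    by (subst sylvester_index_mat2) (auto simp: degf N_def M_def e_def)
  have LS: "(L * S) $$ (i, j) = coeff (h i) (M - j) - a * coeff (h i) (Suc (M - j))
      + (if i = M \<and> j = M then poly g a else 0)" if ij: "i < N" "j < N" for i j
  proof -
    have "(L * S) $$ (i, j) = (\<Sum>k = 0..<N. L $$ (i, k) * S $$ (k, j))"
      using ij carr by (simp add: scalar_prod_def)
    also have "\<dots> = (\<Sum>k = 0..<N. (if k = i then 1 else if e \<le> i \<and> k = Suc i then - a else 0) * S $$ (k, j))"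
      using ij by (intro sum.cong) (auto simp: L_def)
    also have "\<dots> = S $$ (i, j) - (if e \<le> i \<and> Suc i < N then a * S $$ (Suc i, j) else 0)"
      by (rule sum_bidiagonal) fact
    also have "\<dots> = coeff ([:- a, 1:] * h i) (Suc (M - j)) + (if i = M \<and> j = M then poly g a else 0)"
    proof -
      have Nj: "N - j = Suc (M - j)" using ij by (simp add: N_def Suc_diff_le)
      consider "i < e" | "e \<le> i" "i < M" | "i = M" "e \<le> i"
        using ij by (fastforce simp: N_def M_def)
      then show ?thesis
      proof cases
        case 1
        then have "i \<noteq> M" by (simp add: M_def)
        moreover have "monom 1 (e - i) * f = [:- a, 1:] * h i"
          using 1 by (simp only: h_def f_def if_True mult.left_commute)
        ultimately show ?thesis using 1 ij S[of i j] Nj by simp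
      next
        case 2
        have "S $$ (i, j) - a * S $$ (Suc i, j) =
                coeff (monom 1 (N - i) * g - smult a (monom 1 (N - Suc i) * g)) (Suc (M - j))"
          using 2 ij S[of i j] S[of "Suc i" j] Nj by (simp add: N_def)
        also have "monom 1 (N - i) * g - smult a (monom 1 (N - Suc i) * g) = [:- a, 1:] * h i"
          using 2 by (simp add: h_def N_def Suc_diff_le monom_Suc algebra_simps)
        finally show ?thesis using 2 by (simp add: N_def)
      next
        case 3
        have "S $$ (i, j) = coeff (monom 1 1 * g) (Suc (M - j))"
          using 3 ij S[of i j] Nj by (simp add: N_def)
        also have "monom 1 1 * g = [:- a, 1:] * h i + monom (poly g a) 1"
          using 3 by (subst g) (simp add: h_def monom_Suc algebra_simps flip: monom_0)
        finally show ?thesis using 3 ij by (auto simp: N_def)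
      qed
    qed
    finally show ?thesis unfolding coeff_linear_mult_Suc .
  qed
  have BR: "(B * R) $$ (i, j) = coeff (h i) (M - j) - a * coeff (h i) (Suc (M - j))
      + (if i = M \<and> j = M then poly g a else 0)" if ij: "i < N" "j < N" for i j
  proof -
    have "(B * R) $$ (i, j) = (\<Sum>k = 0..<N. B $$ (i, k) * R $$ (k, j))"
      using ij carr by (simp add: scalar_prod_def)
    also have "\<dots> = (\<Sum>k = 0..<N. (if k = j then B $$ (i, k) else 0)
                       + (if 0 < j \<and> k = j - 1 then - a * B $$ (i, k) else 0))"
      using ij by (intro sum.cong) (auto simp: R_def)
    also have "\<dots> = B $$ (i, j) - (if 0 < j then a * B $$ (i, j - 1) else 0)"
      using ij by (cases j) (auto simp: sum.distrib)
    also have "\<dots> = coeff (h i) (M - j) - a * coeff (h i) (Suc (M - j))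
      + (if i = M \<and> j = M then poly g a else 0)"
    proof (cases j)
      case 0
      then show ?thesis using ij hM[of i] by (auto simp: B_def N_def)
    next
      case (Suc j')
      then have "M - j' = Suc (M - j)" using ij by (simp add: N_def)
      then show ?thesis using Suc ij by (auto simp: B_def N_def)
    qed
    finally show ?thesis .
  qed
  \<comment> \<open>Both base changes stay as factors of determinant \<open>1\<close>, so neither
    has to be inverted.\<close>
  have "L * S = B * R"
    using carr LS BR by (intro eq_matI) auto
  then have "det L * det S = det B * det R"
    using carr det_mult by metis
  then have "det S = det B"
    unfolding L_def R_def det_bidiagonal by simp
  \<comment> \<open>For \<open>i < M\<close> the polynomials \<open>h i\<close> are the Sylvester
    rows of \<open>p\<close> and \<open>g\<close>. All constant terms vanish, so the last column is
    zero above the corner \<open>g(a)\<close>.\<close>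
  also have "B = four_block_mat (sylvester_mat p g) (0\<^sub>m M 1)
      (mat 1 M (\<lambda>(i, j). coeff (h M) (M - j))) (mat 1 1 (\<lambda>_. poly g a))"
    (is "_ = ?F")
  proof (rule eq_matI)
    show "dim_row B = dim_row ?F" "dim_col B = dim_col ?F"
      by (simp_all add: B_def N_def M_def e_def)
    fix i j assume "i < dim_row ?F" "j < dim_col ?F"
    then have ij: "i \<le> M" "j \<le> M" by (simp_all add: M_def e_def)
    show "B $$ (i, j) = ?F $$ (i, j)"
    proof (cases "i < M \<and> j < M")
      case True
      then have "sylvester_mat p g $$ (i, j) = coeff (h i) (M - j)"
        by (subst sylvester_index_mat2) (auto simp: M_def e_def h_def)
      with True show ?thesis by (auto simp: B_def N_def M_def e_def)
    next
      case False
      then show ?thesis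
        using ij h0[of i] by (auto simp: B_def N_def M_def e_def)
    qed
  qed
  also have "det ?F = det (sylvester_mat p g) * det (mat 1 1 (\<lambda>_. poly g a))"
    by (rule det_four_block_mat_upper_right_zero[of _ M _ 1])
      (use sylvester_carrier_mat[of p g] in \<open>auto simp: M_def e_def\<close>)
  also have "det (mat 1 1 (\<lambda>_. poly g a)) = poly g a"
    by (simp add: det_single)
  finally show ?thesis
    by (simp add: resultant_def S_def f_def mult.commute)
qed

lemma resultant_prod_linear_left:
  fixes g :: "'a::idom poly"
  assumes "finite A"
  shows "resultant (\<Prod>a\<in>A. [:- f a, 1:]) g = (\<Prod>a\<in>A. poly g (f a))"
  using assms
proof (induction A rule: finite_induct)
  case (insert x A)
  have "(\<Prod>a\<in>A. [:- f a, 1:]) \<noteq> 0"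
    using insert.hyps by (simp add: prod_zero_iff)
  then show ?case
    using insert by (simp add: resultant_linear_mult_left del: mult_pCons_left)
qed simp

text \<open>Both sides are monic of degree \<open>m\<close>, so a nonzero difference would have
  degree below \<open>m\<close> and still vanish at \<open>m\<close> distinct points.\<close>

lemma Q_poly_eq_prod_linear:
  fixes I :: "'a::idom"
  assumes "finite A" "card A = m" "m > 0" "inj_on r A" "\<And>a. a \<in> A \<Longrightarrow> r a ^ m = I ^ m"
  shows "Q_poly m I = (\<Prod>a\<in>A. [:- r a, 1:])"
proof (rule ccontr)
  define P where "P = (\<Prod>a\<in>A. [:- r a, 1:])"
  define d where "d = Q_poly m I - P"
  have Q: "Q_poly m I = monom 1 m - [:I ^ m:]"
    by (simp add: Q_poly_def monom_altdef)
  have degP: "degree P = m"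
    unfolding P_def using assms(2) by (subst degree_prod_sum_eq) auto
  have "lead_coeff P = 1"
    unfolding P_def by (subst lead_coeff_prod) simp
  then have "coeff d m = 0"
    using \<open>m > 0\<close> degP by (simp add: d_def Q coeff_pCons split: nat.split)
  moreover have "degree d \<le> m"
    unfolding d_def Q using degP
    by (intro degree_diff_le) (auto intro: degree_monom_le)
  moreover assume "Q_poly m I \<noteq> (\<Prod>a\<in>A. [:- r a, 1:])"
  then have "d \<noteq> 0" by (simp add: d_def P_def)
  ultimately have "degree d < m"
    using eq_zero_or_degree_less by blast
  moreover have "r ` A \<subseteq> {x. poly d x = 0}"
    using assms by (auto simp: d_def P_def Q_poly_def poly_prod prod_zero_iff)
  then have "card (r ` A) \<le> card {x. poly d x = 0}"
    by (intro card_mono poly_roots_finite \<open>d \<noteq> 0\<close>)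
  then have "m \<le> degree d"
    using card_image[OF assms(4)] assms(2) card_poly_roots_bound[OF \<open>d \<noteq> 0\<close>] by simp
  ultimately show False by simp
qed

section \<open>The iterated resultant over pairs of roots of unity\<close>

lemma ii_mult_ii_mult: "\<i> * (\<i> * z) = - z"
  by (simp flip: mult.assoc)

text \<open>The outermost variable is substituted first: \<open>v = \<i> * b\<close>, then
  \<open>u = \<i> * a\<close>. What remains is linear in \<open>w\<close>, with a constant term that
  factors.\<close>

lemma poly_W_poly_roots:
  "poly (poly W_poly [:[:\<i> * b:]:]) [:\<i> * a:] =
   [:\<i> * ((a - 1) * (b - 1) * (a * b - 1)), 2 * (a * b):]"
  by (simp add: W_poly_def Let_def power2_eq_square numeral_poly one_pCons algebra_simps ii_mult_ii_mult)

text \<open>Each elimination evaluates at the roots of \<open>Q\<close>, which enter as constants of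
  the coefficient ring: first in C[w][u], then in C[w].\<close>

lemma iterated_resultant_eq_prod:
  assumes "m > 0"
  shows "iterated_resultant m = (\<Prod>a | a ^ m = 1. \<Prod>b | b ^ m = 1.
           [:\<i> * ((a - 1) * (b - 1) * (a * b - 1)), 2 * (a * b):])"
proof -
  have fin: "finite {z::complex. z ^ m = 1}"
    using assms by (intro finite_roots_unity) simp
  note [simp] = card_roots_unity_eq[OF assms] poly_const_pow
  have "Q_poly m [:[:\<i>:]:] = (\<Prod>b | b ^ m = 1. [:- [:[:\<i> * b:]:], 1:])"
    using fin assms by (intro Q_poly_eq_prod_linear)
      (auto simp: inj_on_def power_mult_distrib)
  then have 1: "resultant (Q_poly m [:[:\<i>:]:]) W_poly = (\<Prod>b | b ^ m = 1. poly W_poly [:[:\<i> * b:]:])"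
    by (simp only: resultant_prod_linear_left[OF fin])
  have "Q_poly m [:\<i>:] = (\<Prod>b | b ^ m = 1. [:- [:\<i> * b:], 1:])"
    using fin assms by (intro Q_poly_eq_prod_linear)
      (auto simp: inj_on_def power_mult_distrib)
  then show ?thesis
    unfolding iterated_resultant_def 1
    using resultant_prod_linear_left[OF fin, where f = "\<lambda>b. [:\<i> * b:]"]
    by (simp add: poly_prod poly_W_poly_roots)
qed

text \<open>With \<open>?P\<close> the product of all roots, the inner product is
  \<open>a ^ m * ?P = ?P\<close>. The total \<open>?P ^ m\<close> is a product of
  \<open>m\<close>-th powers of roots of unity, so the sign of \<open>?P\<close> is
  irrelevant.\<close>

lemma prod_roots_unity_mult:
  fixes m :: nat
  assumes "m > 0"
  shows "(\<Prod>a | a ^ m = 1. \<Prod>b | b ^ m = 1. a * b :: complex) = 1"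
proof -
  let ?P = "\<Prod>{z::complex. z ^ m = 1}"
  have "(\<Prod>a | a ^ m = 1. \<Prod>b | b ^ m = 1. a * b :: complex) = (\<Prod>a | a ^ m = (1::complex). ?P)"
    by (rule prod.cong[OF refl]) (simp add: prod.distrib card_roots_unity_eq[OF assms])
  also have "\<dots> = ?P ^ m"
    by (simp add: card_roots_unity_eq[OF assms])
  also have "\<dots> = 1"
    by (simp add: prod_power_distrib)
  finally show ?thesis .
qed

subsection \<open>The sine product polynomial\<close>

text \<open>The first two entries of the triples: as \<open>0 < j + l < 2 * m\<close>, the third
  class is nonzero exactly when \<open>j + l \<noteq> m\<close>.\<close>

definition verlinde_pairs :: "nat \<Rightarrow> (nat \<times> nat) set" where
  "verlinde_pairs m = {(j, l). j \<in> {1..<m} \<and> l \<in> {1..<m} \<and> j + l \<noteq> m}"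

text \<open>The negative of the root in \<open>w\<close> of the factor belonging to
  \<open>(j, l)\<close>. The constant \<open>4\<close> is
  \<open>\<i> * (2 * \<i>) ^ 3 / 2\<close>.\<close>

definition sine_product :: "nat \<Rightarrow> nat \<Rightarrow> nat \<Rightarrow> real" where
  "sine_product m j l =
     4 * sin (pi * real j / real m) * sin (pi * real l / real m) * sin (pi * real (j + l) / real m)"

definition sine_poly :: "nat \<Rightarrow> complex poly" where
  "sine_poly m = (\<Prod>(j, l)\<in>verlinde_pairs m. [:of_real (sine_product m j l), 1:])"

lemma cis_double_minus_1: "cis (2 * x) - 1 = 2 * \<i> * of_real (sin x) * cis x"
  by (simp add: complex_eq_iff cos_double_sin sin_double power2_eq_square)

text \<open>The half-angle identity is applied at \<open>x\<close>, \<open>y\<close> and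
  \<open>x + y\<close>; the three phases multiply to
  \<open>cis (2 * (x + y)) = a * b\<close>.\<close>

lemma root_factor_eq_sine_product:
  fixes m j l :: nat
  defines "a \<equiv> cis (2 * pi * real j / real m)" and "b \<equiv> cis (2 * pi * real l / real m)"
  shows "\<i> * ((a - 1) * (b - 1) * (a * b - 1)) = 2 * (a * b) * of_real (sine_product m j l)"
proof -
  define x where "x = pi * real j / real m"
  define y where "y = pi * real l / real m"
  have xy: "pi * real (j + l) / real m = x + y"
    by (simp add: x_def y_def ring_distribs add_divide_distrib)
  have a: "a = cis (2 * x)" and b: "b = cis (2 * y)" and ab: "a * b = cis (2 * (x + y))"
    by (simp_all add: a_def b_def x_def y_def cis_mult ring_distribs mult.assoc)
  have "cis x * cis y * cis (x + y) = a * b"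
    unfolding ab by (simp add: cis_mult algebra_simps)
  moreover have "\<i> * ((a - 1) * (b - 1) * (a * b - 1)) =
      8 * (cis x * cis y * cis (x + y)) * of_real (sin x * sin y * sin (x + y))"
    unfolding ab unfolding a b cis_double_minus_1
    by (simp add: ii_mult_ii_mult mult.assoc mult.left_commute)
  ultimately show ?thesis
    unfolding sine_product_def xy by (simp flip: x_def y_def)
qed

section \<open>Counting the pairs and locating the zeros of the sine product\<close>

lemma verlinde_pairs_eq_Sigma: "verlinde_pairs m = (SIGMA j:{1..<m}. {1..<m} - {m - j})"
  by (auto simp: verlinde_pairs_def)

lemma finite_verlinde_pairs [simp]: "finite (verlinde_pairs m)"
  by (simp add: verlinde_pairs_eq_Sigma)

lemma card_verlinde_pairs: "card (verlinde_pairs m) = (m - 1) * (m - 2)"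
proof -
  have "card (verlinde_pairs m) = (\<Sum>j = 1..<m. card ({1..<m} - {m - j}))"
    unfolding verlinde_pairs_eq_Sigma by (rule card_SigmaI) auto
  also have "\<dots> = (\<Sum>j = 1..<m. m - 2)"
    by (intro sum.cong refl) (subst card_Diff_singleton, auto)
  finally show ?thesis by simp
qed

lemma sine_product_eq_0:
  assumes "j < m" "l < m" "(j, l) \<notin> verlinde_pairs m"
  shows "sine_product m j l = 0"
proof -
  have "j = 0 \<or> l = 0 \<or> j + l = m"
    using assms by (auto simp: verlinde_pairs_def)
  then show ?thesis
    using assms by (auto simp: sine_product_def simp del: of_nat_add)
qed

text \<open>A zero would make \<open>k\<close> a multiple of \<open>m\<close>, and only
  \<open>m\<close> itself lies strictly between \<open>0\<close> and \<open>2 * m\<close>. The range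
  is wide enough for \<open>k = j + l\<close>.\<close>

lemma sin_pi_frac_neq_0:
  assumes "0 < k" "k < 2 * m" "k \<noteq> m"
  shows "sin (pi * real k / real m) \<noteq> 0"
proof
  assume "sin (pi * real k / real m) = 0"
  then obtain i :: int where "pi * real k / real m = of_int i * pi"
    unfolding sin_zero_iff_int2 by blast
  then have "real k = of_int i * real m"
    using assms by (simp add: field_simps)
  then have i: "int k = i * int m"
    by (metis of_int_eq_iff of_int_mult of_int_of_nat_eq)
  have "\<not> i \<le> 0"
  proof
    assume "i \<le> 0"
    then have "i * int m \<le> 0" by (simp add: mult_nonpos_nonneg)
    with i assms show False by linarith
  qed
  moreover have "i * int m < 2 * int m" using i assms by linarith
  then have "i < 2" using assms by simp
  ultimately have "i = 1" by simp
  with i assms show False by simp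
qed

lemma sine_product_neq_0:
  assumes "(j, l) \<in> verlinde_pairs m"
  shows "sine_product m j l \<noteq> 0"
proof -
  have jl: "0 < j" "j < m" "0 < l" "l < m" "j + l \<noteq> m"
    using assms by (auto simp: verlinde_pairs_def)
  show ?thesis
    using jl sin_pi_frac_neq_0[of j m] sin_pi_frac_neq_0[of l m] sin_pi_frac_neq_0[of "j + l" m]
    by (simp add: sine_product_def del: of_nat_add)
qed

text \<open>The scalars \<open>2 * a * b\<close> contribute \<open>2 ^ (m ^ 2)\<close>, since the
  product of all \<open>a * b\<close> is \<open>1\<close>; each pair outside
  \<open>verlinde_pairs\<close> contributes one factor \<open>w\<close>.\<close>

lemma iterated_resultant_eq_sine_poly:
  assumes "m \<ge> 3"
  shows "iterated_resultant m = monom (2 ^ (m ^ 2)) (3 * m - 2) * sine_poly m"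
proof -
  define \<zeta> where "\<zeta> k = cis (2 * pi * real k / real m)" for k
  have bij: "bij_betw \<zeta> {..<m} {z. z ^ m = 1}"
    unfolding \<zeta>_def using assms by (intro bij_betw_roots_unity) simp
  let ?U = "{..<m} \<times> {..<m}"
  let ?x = "\<lambda>j l. complex_of_real (sine_product m j l)"
  have "iterated_resultant m = (\<Prod>j<m. \<Prod>l<m.
          [:\<i> * ((\<zeta> j - 1) * (\<zeta> l - 1) * (\<zeta> j * \<zeta> l - 1)), 2 * (\<zeta> j * \<zeta> l):])"
    using assms by (subst iterated_resultant_eq_prod) (auto simp flip: prod.reindex_bij_betw[OF bij])
  also have "\<dots> = (\<Prod>j<m. \<Prod>l<m. smult (2 * (\<zeta> j * \<zeta> l)) [:?x j l, 1:])"
    unfolding \<zeta>_def root_factor_eq_sine_product by (intro prod.cong refl) simp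
  also have "\<dots> = smult (\<Prod>j<m. \<Prod>l<m. 2 * (\<zeta> j * \<zeta> l)) (\<Prod>(j, l)\<in>?U. [:?x j l, 1:])"
    by (simp only: prod_smult prod.cartesian_product)
  also have "(\<Prod>j<m. \<Prod>l<m. 2 * (\<zeta> j * \<zeta> l)) = 2 ^ (m ^ 2) * (\<Prod>j<m. \<Prod>l<m. \<zeta> j * \<zeta> l)"
    by (simp add: prod.distrib power2_eq_square power_mult)
  also have "(\<Prod>j<m. \<Prod>l<m. \<zeta> j * \<zeta> l) = 1"
    using prod_roots_unity_mult[of m] assms by (simp flip: prod.reindex_bij_betw[OF bij])
  also have "(\<Prod>(j, l)\<in>?U. [:?x j l, 1:]) =
      (\<Prod>(j, l)\<in>?U - verlinde_pairs m. [:?x j l, 1:]) * sine_poly m"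
    unfolding sine_poly_def
    by (rule prod.subset_diff) (auto simp: verlinde_pairs_def)
  also have "(\<Prod>(j, l)\<in>?U - verlinde_pairs m. [:?x j l, 1:]) = (\<Prod>_\<in>?U - verlinde_pairs m. [:0, 1:])"
    by (intro prod.cong refl) (auto simp: sine_product_eq_0)
  also have "\<dots> = monom 1 (3 * m - 2)"
  proof -
    have "verlinde_pairs m \<subseteq> ?U"
      by (auto simp: verlinde_pairs_def)
    then have "card (?U - verlinde_pairs m) = m * m - (m - 1) * (m - 2)"
      by (simp add: card_Diff_subset card_verlinde_pairs)
    also have "\<dots> = 3 * m - 2"
    proof -
      \<comment> \<open>This substitution removes the truncated subtractions.\<close>
      obtain k where "m = k + 3" using assms by (metis add.commute le_Suc_ex)
      then show ?thesis by (simp add: algebra_simps)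
    qed
    finally show ?thesis by (simp add: monom_altdef)
  qed
  finally show ?thesis
    by (simp add: smult_monom flip: mult_smult_left)
qed

section \<open>Degree, leading coefficient and parity of \<open>D\<close>\<close>

lemma D_fract_eq_sine_poly:
  assumes "m \<ge> 3"
  shows "D_fract m = to_fract (sine_poly m)"
  unfolding D_fract_def iterated_resultant_eq_sine_poly[OF assms] to_fract_def
  by (simp add: eq_fract monom_eq_0_iff)

lemma degree_sine_poly: "degree (sine_poly m) = (m - 1) * (m - 2)"
  unfolding sine_poly_def
  by (subst degree_prod_sum_eq) (auto simp: case_prod_unfold card_verlinde_pairs)

lemma lead_coeff_sine_poly: "lead_coeff (sine_poly m) = 1"
  unfolding sine_poly_def by (subst lead_coeff_prod) (simp add: case_prod_unfold)

lemma bij_betw_verlinde_pairs_reflect: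
  "bij_betw (\<lambda>(j, l). (m - j, m - l)) (verlinde_pairs m) (verlinde_pairs m)"
  by (rule bij_betw_byWitness[where f' = "\<lambda>(j, l). (m - j, m - l)"])
    (auto simp: verlinde_pairs_def)

text \<open>The angles become \<open>pi - x\<close>, \<open>pi - y\<close> and
  \<open>2 * pi - (x + y)\<close>: only the third sine changes sign.\<close>

lemma sine_product_reflect:
  assumes "(j, l) \<in> verlinde_pairs m"
  shows "sine_product m (m - j) (m - l) = - sine_product m j l"
proof -
  have jl: "j < m" "l < m" using assms by (auto simp: verlinde_pairs_def)
  define x where "x = pi * real j / real m"
  define y where "y = pi * real l / real m"
  have "pi * real (m - j) / real m = pi - x" "pi * real (m - l) / real m = pi - y"
    "pi * real (m - j + (m - l)) / real m = 2 * pi - (x + y)"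
    "pi * real (j + l) / real m = x + y"
    using jl by (simp_all add: x_def y_def field_simps of_nat_diff)
  then show ?thesis
    unfolding sine_product_def by (simp add: sin_diff flip: x_def y_def)
qed

lemma sine_poly_altdef:
  "sine_poly m = (\<Prod>(j, l)\<in>verlinde_pairs m. [:- of_real (sine_product m j l), 1:])"
  unfolding sine_poly_def
  by (subst prod.reindex_bij_betw[OF bij_betw_verlinde_pairs_reflect, symmetric])
    (auto intro!: prod.cong simp: sine_product_reflect)

text \<open>Substituting \<open>- w\<close> turns each factor \<open>w + x\<close> into
  \<open>- (w - x)\<close>. The roots are symmetric under negation, and the number of signs is a
  product of consecutive integers, hence even.\<close>

lemma even_sine_poly:
  assumes "m \<ge> 3"
  shows "pcompose (sine_poly m) [:0, -1:] = sine_poly m"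
proof -
  have "pcompose (sine_poly m) [:0, -1:] =
      (\<Prod>p\<in>verlinde_pairs m. - 1 * (case p of (j, l) \<Rightarrow> [:- of_real (sine_product m j l), 1:]))"
    unfolding sine_poly_def pcompose_prod
    by (intro prod.cong refl) (auto simp: pcompose_pCons)
  also have "\<dots> = (- 1) ^ ((m - 1) * (m - 2)) * sine_poly m"
    unfolding prod.distrib sine_poly_altdef by (simp add: card_verlinde_pairs)
  also have "even ((m - 1) * (m - 2))"
    using assms by auto
  then have "(- 1) ^ ((m - 1) * (m - 2)) * sine_poly m = sine_poly m" by simp
  finally show ?thesis .
qed

subsection \<open>The generating series\<close>

text \<open>The sum is a multiple of \<open>m\<close> strictly between \<open>0\<close> and
  \<open>3 * m\<close>.\<close>

lemma verlinde_triples_sum_cases: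
  assumes "(j, l, k) \<in> verlinde_triples m"
  shows "j + l + k = m \<or> j + l + k = 2 * m"
proof -
  have "m dvd j + l + k" and "0 < j + l + k" "j + l + k < 3 * m"
    using assms by (auto simp: verlinde_triples_def cong_0_iff)
  then obtain q where q: "j + l + k = m * q" by blast
  with \<open>0 < j + l + k\<close> \<open>j + l + k < 3 * m\<close> have "0 < q" "m * q < m * 3"
    by (simp_all add: mult.commute)
  then have "q = 1 \<or> q = 2" by auto
  with q show ?thesis by auto
qed

lemma bij_betw_verlinde_triples:
  "bij_betw (\<lambda>(j, l, k). (j, l)) (verlinde_triples m) (verlinde_pairs m)"
proof -
  let ?f = "\<lambda>(j, l, k). (j, l)"
  \<comment> \<open>The third entry is the representative of \<open>- (j + l)\<close> in
    \<open>1, ..., m - 1\<close>.\<close>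
  let ?g = "\<lambda>(j, l). (j, l, if j + l < m then m - (j + l) else 2 * m - (j + l))"
  have "?f t \<in> verlinde_pairs m \<and> ?g (?f t) = t" if "t \<in> verlinde_triples m" for t
  proof -
    obtain j l k where [simp]: "t = (j, l, k)" by (cases t)
    have "j + l + k = m \<or> j + l + k = 2 * m" "0 < j" "j < m" "0 < l" "l < m" "0 < k" "k < m"
      using verlinde_triples_sum_cases[of j l k m] that by (auto simp: verlinde_triples_def)
    then show ?thesis
      by (auto simp: verlinde_pairs_def)
  qed
  moreover have "?g ` verlinde_pairs m \<subseteq> verlinde_triples m"
    by (auto simp: verlinde_triples_def verlinde_pairs_def cong_0_iff)
  ultimately show ?thesis
    by (intro bij_betw_byWitness[where f' = ?g]) auto
qed

text \<open>The third angle is \<open>pi - x\<close> or \<open>2 * pi - x\<close>, so its sine is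
  that of \<open>x\<close> up to a sign, which squaring removes.\<close>

lemma sin_third_angle_squared:
  assumes "(j, l, k) \<in> verlinde_triples m"
  shows "(sin (pi * real k / real m))\<^sup>2 = (sin (pi * real (j + l) / real m))\<^sup>2"
proof -
  have m: "m > 0" using assms by (auto simp: verlinde_triples_def)
  define x where "x = pi * real (j + l) / real m"
  consider "j + l + k = m" | "j + l + k = 2 * m"
    using verlinde_triples_sum_cases[OF assms] by blast
  then have "pi * real k / real m = pi - x \<or> pi * real k / real m = 2 * pi - x"
  proof cases
    case 1
    then have "real k = real m - real (j + l)" by linarith
    then show ?thesis using m by (simp add: x_def right_diff_distrib diff_divide_distrib del: of_nat_add)
  next
    case 2
    then have "real k = 2 * real m - real (j + l)" by linarith
    then show ?thesis using m by (simp add: x_def right_diff_distrib diff_divide_distrib del: of_nat_add)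
  qed
  then show ?thesis
    unfolding x_def[symmetric] by (auto simp: sin_diff)
qed

text \<open>The square of the eightfold sine product is \<open>4 * x^2\<close>, and
  \<open>3 ^ n * real m ^ (2 * n)\<close> completes the ratio \<open>c_m / x^2\<close>. The
  convention for \<open>n = 0\<close> agrees, as it counts the pairs.\<close>

lemma verlinde_SU3_eq_sum:
  assumes "m \<ge> 3"
  shows "verlinde_SU3 n m =
         (\<Sum>(j, l)\<in>verlinde_pairs m. (3 * real m ^ 2 / 4 / (sine_product m j l)\<^sup>2) ^ n)"
proof (cases "n = 0")
  case True
  then show ?thesis
    using assms by (simp add: verlinde_SU3_def case_prod_unfold card_verlinde_pairs of_nat_diff)
next
  case False
  have "(8 * sin (pi * real j / real m) * sin (pi * real l / real m) * sin (pi * real k / real m))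
          powi (- (2 * int n)) = (1 / (4 * (sine_product m j l)\<^sup>2)) ^ n"
    if "(j, l, k) \<in> verlinde_triples m" for j l k
  proof -
    have "(8 * sin (pi * real j / real m) * sin (pi * real l / real m) * sin (pi * real k / real m))
            powi (- (2 * int n)) =
          (1 / (8 * sin (pi * real j / real m) * sin (pi * real l / real m) * sin (pi * real k / real m))\<^sup>2) ^ n"
      by (simp add: power_int_def power_mult power_inverse nat_mult_distrib inverse_eq_divide power_one_over)
    also have "(8 * sin (pi * real j / real m) * sin (pi * real l / real m) * sin (pi * real k / real m))\<^sup>2
        = 4 * (sine_product m j l)\<^sup>2"
      unfolding sine_product_def power_mult_distrib sin_third_angle_squared[OF that] by simp
    finally show ?thesis .
  qed
  then have "verlinde_SU3 n m = 3 ^ n * real m ^ (2 * n) *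
      (\<Sum>(j, l, k)\<in>verlinde_triples m. (1 / (4 * (sine_product m j l)\<^sup>2)) ^ n)"
    using False unfolding verlinde_SU3_def by (auto intro!: sum.cong)
  also have "(\<Sum>(j, l, k)\<in>verlinde_triples m. (1 / (4 * (sine_product m j l)\<^sup>2)) ^ n) =
      (\<Sum>(j, l)\<in>verlinde_pairs m. (1 / (4 * (sine_product m j l)\<^sup>2)) ^ n)"
    by (subst sum.reindex_bij_betw[OF bij_betw_verlinde_triples, symmetric])
      (simp add: case_prod_unfold)
  also have "3 ^ n * real m ^ (2 * n) * \<dots> =
      (\<Sum>(j, l)\<in>verlinde_pairs m. (3 * real m ^ 2 / 4 / (sine_product m j l)\<^sup>2) ^ n)"
    unfolding sum_distrib_left
    by (intro sum.cong refl)
      (auto simp: power_mult power_divide power_mult_distrib)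
  finally show ?thesis .
qed

section \<open>Logarithmic derivative and geometric series\<close>

lemma poly_sine_poly:
  "poly (sine_poly m) s = (\<Prod>(j, l)\<in>verlinde_pairs m. s + of_real (sine_product m j l))"
  by (simp add: sine_poly_def poly_prod case_prod_unfold add.commute)

lemma pderiv_sine_poly_over:
  assumes "poly (sine_poly m) s \<noteq> 0"
  shows "poly (pderiv (sine_poly m)) s / poly (sine_poly m) s =
         (\<Sum>(j, l)\<in>verlinde_pairs m. 1 / (s + of_real (sine_product m j l)))"
proof -
  let ?f = "\<lambda>p. s + of_real (case p of (j, l) \<Rightarrow> sine_product m j l)"
  have D: "poly (sine_poly m) s = prod ?f (verlinde_pairs m)"
    by (simp add: poly_sine_poly case_prod_unfold)
  have "poly (pderiv (sine_poly m)) s = (\<Sum>p\<in>verlinde_pairs m. prod ?f (verlinde_pairs m - {p}))"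
    unfolding sine_poly_def
    by (simp add: pderiv_prod pderiv_pCons poly_sum poly_prod case_prod_unfold add.commute)
  also have "\<dots> / poly (sine_poly m) s = (\<Sum>p\<in>verlinde_pairs m. 1 / ?f p)"
    unfolding sum_divide_distrib
  proof (rule sum.cong[OF refl])
    have cancel: "b / (a * b) = 1 / a" if "b \<noteq> 0" for a b :: complex
      using that by simp
    fix p assume p: "p \<in> verlinde_pairs m"
    then have "poly (sine_poly m) s = ?f p * prod ?f (verlinde_pairs m - {p})"
      unfolding D by (intro prod.remove) auto
    moreover from this assms have "prod ?f (verlinde_pairs m - {p}) \<noteq> 0"
      by auto
    ultimately show "prod ?f (verlinde_pairs m - {p}) / poly (sine_poly m) s = 1 / ?f p"
      by (metis cancel)
  qed
  finally show ?thesis by (simp add: case_prod_unfold)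
qed

text \<open>Both sides equal \<open>2 * s^2 / (s^2 - x^2)\<close>; the right-hand form exposes the
  sum of the geometric series with ratio \<open>s^2 / x^2\<close>.\<close>

lemma sum_conjugate_fractions:
  fixes s x :: "'a::field"
  assumes "x \<noteq> 0" "s\<^sup>2 \<noteq> x\<^sup>2"
  shows "s / (s + x) + s / (s - x) = 2 * (1 - 1 / (1 - s\<^sup>2 / x\<^sup>2))"
proof -
  have "s + x \<noteq> 0" "s - x \<noteq> 0"
    using assms(2) by (auto simp: power2_eq_iff add_eq_0_iff2)
  then have "s / (s + x) + s / (s - x) = 2 * s\<^sup>2 / (s\<^sup>2 - x\<^sup>2)"
    by (simp add: add_frac_eq power2_eq_square algebra_simps)
  also have "\<dots> = 2 * (1 - x\<^sup>2 / (x\<^sup>2 - s\<^sup>2))"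
    using assms(2) by (simp add: divide_simps) (simp add: algebra_simps)
  also have "x\<^sup>2 / (x\<^sup>2 - s\<^sup>2) = 1 / (1 - s\<^sup>2 / x\<^sup>2)"
    using assms by (simp add: diff_divide_eq_iff)
  finally show ?thesis .
qed

text \<open>
  The reflection \<open>(j, l) \<mapsto> (m - j, m - l)\<close> negates the sine product, so the terms
  \<open>s/(s + x)\<close> and \<open>s/(s - x)\<close> may be averaged.
\<close>
lemma sum_geometric_eq_log_derivative:
  assumes "\<And>j l. (j, l) \<in> verlinde_pairs m \<Longrightarrow> s\<^sup>2 \<noteq> (of_real (sine_product m j l))\<^sup>2"
  shows "(\<Sum>(j, l)\<in>verlinde_pairs m. 1 / (1 - s\<^sup>2 / (of_real (sine_product m j l))\<^sup>2)) =
         of_nat (card (verlinde_pairs m))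
         - s * (\<Sum>(j, l)\<in>verlinde_pairs m. 1 / (s + complex_of_real (sine_product m j l)))"
proof -
  let ?x = "\<lambda>p. complex_of_real (case p of (j, l) \<Rightarrow> sine_product m j l)"
  let ?T = "verlinde_pairs m"
  have reflect: "(\<Sum>p\<in>?T. s / (s + ?x p)) = (\<Sum>p\<in>?T. s / (s - ?x p))"
    by (subst sum.reindex_bij_betw[OF bij_betw_verlinde_pairs_reflect, symmetric])
      (auto intro!: sum.cong simp: sine_product_reflect)
  have "2 * (\<Sum>p\<in>?T. s / (s + ?x p)) = (\<Sum>p\<in>?T. s / (s + ?x p) + s / (s - ?x p))"
    unfolding sum.distrib reflect[symmetric] by simp
  also have "\<dots> = (\<Sum>p\<in>?T. 2 * (1 - 1 / (1 - s\<^sup>2 / (?x p)\<^sup>2)))"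
  proof (rule sum.cong[OF refl])
    fix p assume p: "p \<in> ?T"
    obtain j l where jl: "p = (j, l)" by (cases p)
    have x: "?x p \<noteq> 0" using sine_product_neq_0[of j l m] p jl by simp
    have ne: "s\<^sup>2 \<noteq> (?x p)\<^sup>2" using assms[of j l] p jl by simp
    then show "s / (s + ?x p) + s / (s - ?x p) = 2 * (1 - 1 / (1 - s\<^sup>2 / (?x p)\<^sup>2))"
      using sum_conjugate_fractions x by blast
  qed
  also have "\<dots> = 2 * (of_nat (card ?T) - (\<Sum>p\<in>?T. 1 / (1 - s\<^sup>2 / (?x p)\<^sup>2)))"
    unfolding sum_distrib_left[symmetric] sum_subtractf by simp
  finally have "(\<Sum>p\<in>?T. s / (s + ?x p)) = of_nat (card ?T) - (\<Sum>p\<in>?T. 1 / (1 - s\<^sup>2 / (?x p)\<^sup>2))"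
    by (subst (asm) mult_cancel_left) simp
  then show ?thesis
    by (simp add: sum_distrib_left case_prod_unfold)
qed

theorem theorem1p2:
  fixes m :: nat
  assumes "m \<ge> 3"
  shows "\<exists>D :: complex poly.
           D_fract m = to_fract D \<and>
           pcompose D [:0, -1:] = D \<and>
           lead_coeff D = 1 \<and>
           degree D = (m - 1) * (m - 2) \<and>
           (\<forall>\<^sub>F \<tau> in nhds (0 :: complex).
              \<forall>s :: complex. s ^ 2 = of_real (3 * real m ^ 2 / 4) * \<tau> \<longrightarrow>
                poly D s \<noteq> 0 \<and>
                (\<lambda>n. of_real (verlinde_SU3 n m) * \<tau> ^ n) sums
                  (of_real ((real m - 1) * (real m - 2)) - s * (poly (pderiv D) s / poly D s)))"
proof (intro exI[of _ "sine_poly m"] conjI)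
  define c where "c = 3 * real m ^ 2 / 4"
  let ?T = "verlinde_pairs m"
  let ?x = "\<lambda>p. complex_of_real (case p of (j, l) \<Rightarrow> sine_product m j l)"
  \<comment> \<open>The ratio is continuous in \<open>\<tau>\<close> and zero at \<open>0\<close>;
    finiteness of \<open>?T\<close> then yields one neighbourhood for all pairs.\<close>
  have "\<forall>\<^sub>F \<tau> in nhds 0. norm (of_real c * \<tau> / (?x p)\<^sup>2) < 1" for p
  proof -
    have "((\<lambda>\<tau>. norm (of_real c * \<tau> / (?x p)\<^sup>2)) \<longlongrightarrow> norm (of_real c * 0 / (?x p)\<^sup>2)) (nhds 0)"
      unfolding divide_inverse by (intro tendsto_intros filterlim_ident)
    then show ?thesis by (rule order_tendstoD) simp
  qed
  then have "\<forall>\<^sub>F \<tau> in nhds 0. \<forall>p\<in>?T. norm (of_real c * \<tau> / (?x p)\<^sup>2) < 1"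
    by (intro eventually_ball_finite) auto
  then show "\<forall>\<^sub>F \<tau> in nhds (0 :: complex).
              \<forall>s :: complex. s ^ 2 = of_real (3 * real m ^ 2 / 4) * \<tau> \<longrightarrow>
                poly (sine_poly m) s \<noteq> 0 \<and>
                (\<lambda>n. of_real (verlinde_SU3 n m) * \<tau> ^ n) sums
                  (of_real ((real m - 1) * (real m - 2))
                    - s * (poly (pderiv (sine_poly m)) s / poly (sine_poly m) s))"
    unfolding c_def[symmetric]
  proof (eventually_elim, intro allI impI)
    fix \<tau> s :: complex
    assume small: "\<forall>p\<in>?T. norm (of_real c * \<tau> / (?x p)\<^sup>2) < 1"
      and s: "s\<^sup>2 = of_real c * \<tau>"
    have less: "norm (s\<^sup>2 / (?x p)\<^sup>2) < 1" if "p \<in> ?T" for p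
      using small that by (simp add: s)
    \<comment> \<open>Equality would make the ratio \<open>1\<close>. This keeps \<open>s\<close>
      away from the roots of \<open>D\<close>.\<close>
    have ne: "s\<^sup>2 \<noteq> (?x p)\<^sup>2" if "p \<in> ?T" for p
    proof -
      have "?x p \<noteq> 0" using that sine_product_neq_0 by (cases p) auto
      then show ?thesis using less[OF that] by auto
    qed
    have nz: "poly (sine_poly m) s \<noteq> 0"
      using ne by (fastforce simp: poly_sine_poly prod_zero_iff add_eq_0_iff2)
    \<comment> \<open>One geometric series per pair; only \<open>s^2\<close> enters, so either
      square root gives the same sum.\<close>
    have "(\<lambda>n. \<Sum>p\<in>?T. (s\<^sup>2 / (?x p)\<^sup>2) ^ n) sums (\<Sum>p\<in>?T. 1 / (1 - s\<^sup>2 / (?x p)\<^sup>2))"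
      by (intro sums_sum geometric_sums less)
    also have "(\<lambda>n. \<Sum>p\<in>?T. (s\<^sup>2 / (?x p)\<^sup>2) ^ n) = (\<lambda>n. of_real (verlinde_SU3 n m) * \<tau> ^ n)"
      by (rule ext) (simp add: verlinde_SU3_eq_sum[OF assms] s sum_distrib_right case_prod_unfold
          flip: c_def power_mult_distrib)
    also have "(\<Sum>p\<in>?T. 1 / (1 - s\<^sup>2 / (?x p)\<^sup>2)) = of_nat (card ?T)
        - s * (poly (pderiv (sine_poly m)) s / poly (sine_poly m) s)"
      using sum_geometric_eq_log_derivative[of m s] ne
      by (auto simp: pderiv_sine_poly_over[OF nz] case_prod_unfold)
    also have "of_nat (card ?T) = complex_of_real ((real m - 1) * (real m - 2))"
      using assms by (simp add: card_verlinde_pairs of_nat_diff)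
    finally show "poly (sine_poly m) s \<noteq> 0 \<and> (\<lambda>n. of_real (verlinde_SU3 n m) * \<tau> ^ n) sums
        (of_real ((real m - 1) * (real m - 2))
          - s * (poly (pderiv (sine_poly m)) s / poly (sine_poly m) s))"
      using nz by blast
  qed
qed (use assms lead_coeff_sine_poly[of m] in \<open>simp_all add: D_fract_eq_sine_poly even_sine_poly degree_sine_poly\<close>)

end
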